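(* Let $k,m,n\in\mathbb{Z}$ and let $$N=\begin{pmatrix}16k+4&2m+1\\0&16n+12\end{pmatrix}\quad\text{or}\quad N=\begin{pmatrix}16k+12&2m+1\\0&16n+4\end{pmatrix}\in UT_2(\mathbb{Z}).$$ Then there are no four matrices in $UT_2(\mathbb{Z})$ having the Jordan $D(N)$-property. Consequently, there is no upper-triangular Jordan $D(N)$-quadruple.
   Context: $UT_2(\mathbb{Z})$ denotes the ring of upper-triangular $2\times 2$ integer matrices, and $A\circ B=\frac12(AB+BA)$ (computed over $\mathbb{Q}$) is the Jordan product. For $N\in UT_2(\mathbb{Z})$, four matrices $A_1,A_2,A_3,A_4\in UT_2(\mathbb{Z})$ (not necessarily distinct or nonzero) have the Jordan $D(N)$-property if for every $1\le i<j\le 4$ there exists $X_{ij}\in UT_2(\mathbb{Z})$ with $A_i\circ A_j+N=X_{ij}^2$. If moreover the $A_i$ are distinct and nonzero, then $\{A_1,A_2,A_3,A_4\}$ is called an upper-triangular Jordan $D(N)$-quadruple. *)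

theory Defs
  imports "Jordan_Normal_Form.Matrix"
begin

definition UT2 :: "int mat set" where
  "UT2 = {A \<in> carrier_mat 2 2. upper_triangular A}"

definition ut2 :: "int \<Rightarrow> int \<Rightarrow> int \<Rightarrow> int mat" where
  "ut2 a b d = mat_of_rows_list 2 [[a, b], [0, d]]"

lemma ut2_in_UT2: "ut2 a b d \<in> UT2"
  by (auto simp: UT2_def ut2_def mat_of_rows_list_def upper_triangular_def less_Suc_eq numeral_2_eq_2)

abbreviation rat_mat :: "int mat \<Rightarrow> rat mat" where
  "rat_mat \<equiv> map_mat rat_of_int"

definition jordan_prod :: "rat mat \<Rightarrow> rat mat \<Rightarrow> rat mat"  (infixl "\<circ>\<^sub>J" 70) where
  "A \<circ>\<^sub>J B = (1 / 2) \<cdot>\<^sub>m (A * B + B * A)"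

text \<open>
  The Jordan product of two integer matrices need not be integral, so the defining
  equation is stated over the rationals. Four matrices are given as a function of which only the
  values at \<open>1, \<dots>, 4\<close> matter;
  the property itself requires neither distinctness nor non-vanishing.
\<close>

definition jordan_D_property :: "int mat \<Rightarrow> (nat \<Rightarrow> int mat) \<Rightarrow> bool" where
  "jordan_D_property N A \<longleftrightarrow>
     (\<forall>i\<in>{1..4}. A i \<in> UT2) \<and>
     (\<forall>i j. 1 \<le> i \<and> i < j \<and> j \<le> 4 \<longrightarrow>
        (\<exists>X\<in>UT2. rat_mat (A i) \<circ>\<^sub>J rat_mat (A j) + rat_mat N = rat_mat (X ^\<^sub>m 2)))"

definition jordan_D_quadruple :: "int mat \<Rightarrow> int mat set \<Rightarrow> bool" where
  "jordan_D_quadruple N Q \<longleftrightarrow>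
     (\<exists>A. Q = A ` {1..4} \<and> inj_on A {1..4} \<and> (\<forall>i\<in>{1..4}. A i \<noteq> 0\<^sub>m 2 2) \<and>
          jordan_D_property N A)"

end

theory Submission
  imports Defs
begin

text \<open>
  Write \<open>A\<^sub>i\<close> with diagonal \<open>a\<^sub>i, d\<^sub>i\<close>, corner \<open>b\<^sub>i\<close> and trace \<open>s\<^sub>i = a\<^sub>i + d\<^sub>i\<close>, and \<open>X\<^sub>i\<^sub>j\<close> with
  diagonal \<open>x, z\<close> and corner \<open>y\<close>. Comparing entries, the Jordan property says that
  \<open>a\<^sub>i a\<^sub>j + N\<^sub>1\<^sub>1 = x\<^sup>2\<close>, that \<open>d\<^sub>i d\<^sub>j + N\<^sub>2\<^sub>2 = z\<^sup>2\<close>, and that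
  \<open>s\<^sub>i b\<^sub>j + s\<^sub>j b\<^sub>i + 2 N\<^sub>1\<^sub>2 = 2 y (x + z)\<close>. These three conditions are symmetric under
  exchanging the two diagonals, so one may take \<open>N\<^sub>1\<^sub>1 \<equiv> 4\<close> and \<open>N\<^sub>2\<^sub>2 \<equiv> 12\<close> modulo \<open>16\<close>.

  Both diagonals contain at most two odd entries, by a product argument modulo \<open>8\<close>
  (\<open>no_three_odd_shift_4\<close>). On the diagonal with \<open>12\<close> there is no odd entry at all, since an odd
  one would force the even ones to be divisible by \<open>4\<close>, while \<open>12\<close> is not a square modulo \<open>16\<close>
  (\<open>all_even_shift_12\<close>). Hence \<open>z\<close> is always even, and whenever \<open>a\<^sub>i a\<^sub>j\<close> is even so is \<open>x\<close>; as
  \<open>N\<^sub>1\<^sub>2\<close> is odd, the corner equation then reads \<open>s\<^sub>i b\<^sub>j + s\<^sub>j b\<^sub>i \<equiv> 2\<close> modulo \<open>4\<close>.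

  If some \<open>a\<^sub>i\<close> is odd, then \<open>s\<^sub>i\<close> is odd and this congruence makes \<open>b\<^sub>j\<close> even for each of the at
  least two indices with \<open>a\<^sub>j\<close> even; the congruence fails for two such indices. If all \<open>a\<^sub>i\<close> are
  even, then the four vectors \<open>(s\<^sub>i / 2, b\<^sub>i)\<close> are pairwise linearly independent modulo \<open>2\<close>,
  although the plane over the field with two elements has only three nonzero vectors
  (\<open>card_pairwise_independent_mod_2\<close>).
\<close>

section \<open>Products that become squares after a shift\<close>

lemma square_mod_8_odd:
  fixes x :: int
  assumes "odd x"
  shows "x\<^sup>2 mod 8 = 1"
proof -
  have "x mod 8 = 1 \<or> x mod 8 = 3 \<or> x mod 8 = 5 \<or> x mod 8 = 7"
    using assms by presburger
  moreover have "x\<^sup>2 mod 8 = (x mod 8)\<^sup>2 mod 8"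
    by (simp add: power_mod)
  ultimately show ?thesis
    by auto
qed

text \<open>
  All three products are \<open>5\<close> modulo \<open>8\<close>; but their product is an odd square, hence \<open>1\<close>,
  whereas \<open>5\<^sup>3\<close> is \<open>5\<close>.
\<close>

lemma no_three_odd_shift_4:
  fixes a b c p :: int
  assumes p: "p mod 8 = 4" and odd: "odd a" "odd b" "odd c"
    and squares: "a * b + p = x\<^sup>2" "a * c + p = y\<^sup>2" "b * c + p = z\<^sup>2"
  shows False
proof -
  have prod_mod: "u * v mod 8 = 5" if "odd u" "odd v" "u * v + p = w\<^sup>2" for u v w :: int
  proof -
    have "even p"
      using p by presburger
    then have "odd (w\<^sup>2)"
      using that by (metis even_add even_mult_iff)
    then have "w\<^sup>2 mod 8 = 1"
      using square_mod_8_odd[of w] by simp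
    with that(3) p show ?thesis
      by presburger
  qed
  have "(a * b) * (a * c) * (b * c) mod 8
      = ((a * b mod 8) * (a * c mod 8) mod 8) * (b * c mod 8) mod 8"
    by (simp add: mod_mult_eq mod_mult_left_eq mod_mult_right_eq)
  also have "\<dots> = 5"
    using odd squares prod_mod by simp
  finally have "(a * b * c)\<^sup>2 mod 8 = 5"
    by (simp add: power2_eq_square algebra_simps)
  moreover have "odd (a * b * c)"
    using odd by simp
  ultimately show False
    using square_mod_8_odd by fastforce
qed

lemma two_even_shift_4:
  fixes a :: "'i \<Rightarrow> int"
  assumes "card I = 4" and p: "p mod 8 = 4"
    and squares: "\<And>i j. i \<in> I \<Longrightarrow> j \<in> I \<Longrightarrow> i \<noteq> j \<Longrightarrow> \<exists>x. a i * a j + p = x\<^sup>2"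
  obtains j k where "j \<in> I" "k \<in> I" "j \<noteq> k" "even (a j)" "even (a k)"
proof -
  let ?O = "{i \<in> I. odd (a i)}" and ?E = "{i \<in> I. even (a i)}"
  have fin: "finite I"
    using assms(1) by (simp add: card_ge_0_finite)
  have "card ?O < 3"
  proof (rule ccontr)
    assume "\<not> card ?O < 3"
    then obtain T where "T \<subseteq> ?O" "card T = 3"
      by (meson not_less obtain_subset_with_card_n)
    then obtain i j k where ijk: "{i, j, k} \<subseteq> ?O" "i \<noteq> j" "i \<noteq> k" "j \<noteq> k"
      by (auto simp: card_3_iff)
    then obtain x y z where "a i * a j + p = x\<^sup>2" "a i * a k + p = y\<^sup>2" "a j * a k + p = z\<^sup>2"
      using squares[of i j] squares[of i k] squares[of j k] by auto
    then show False
      using no_three_odd_shift_4[OF p, of "a i" "a j" "a k"] ijk by auto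
  qed
  moreover have "card I = card ?O + card ?E"
    using fin by (subst card_Un_disjoint[symmetric]) (auto intro: arg_cong[where f = card])
  ultimately have "2 \<le> card ?E"
    using assms(1) by linarith
  then obtain T where "T \<subseteq> ?E" "card T = 2"
    by (meson obtain_subset_with_card_n)
  then show thesis
    using that by (auto simp: card_2_iff)
qed

lemma square_mod_16_even:
  fixes z :: int
  assumes "even (z\<^sup>2)"
  shows "z\<^sup>2 mod 16 = 0 \<or> z\<^sup>2 mod 16 = 4"
proof -
  have "even z"
    using assms by simp
  then obtain w where w: "z = 2 * w" ..
  show ?thesis
  proof (cases "even w")
    case True
    then obtain v where "w = 2 * v" ..
    then have "z\<^sup>2 = 16 * v\<^sup>2"
      by (simp add: w power2_eq_square)
    then show ?thesis
      by simp
  next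
    case False
    then have "w\<^sup>2 mod 8 = 1"
      by (rule square_mod_8_odd)
    moreover have "4 * u mod 16 = 4" if "u mod 8 = 1" for u :: int
      using that by presburger
    ultimately show ?thesis
      by (simp add: w power_mult_distrib)
  qed
qed

text \<open>
  An odd entry \<open>d\<^sub>i\<close> makes every even entry a multiple of \<open>4\<close>, because \<open>d\<^sub>i d\<^sub>j + r\<close> is then an even
  square. Two even entries remain, and their product would leave \<open>12\<close> as a square modulo \<open>16\<close>.
\<close>

lemma all_even_shift_12:
  fixes d :: "'i \<Rightarrow> int"
  assumes "card I = 4" and r: "r mod 16 = 12"
    and squares: "\<And>i j. i \<in> I \<Longrightarrow> j \<in> I \<Longrightarrow> i \<noteq> j \<Longrightarrow> \<exists>z. d i * d j + r = z\<^sup>2"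
    and "i \<in> I"
  shows "even (d i)"
proof (rule ccontr)
  assume odd: "odd (d i)"
  have "r mod 8 = 4"
    using r by presburger
  from two_even_shift_4[OF assms(1) this, of d] squares
  obtain j k where jk: "j \<in> I" "k \<in> I" "j \<noteq> k" "even (d j)" "even (d k)"
    by metis
  have prod_mod: "d u * d v mod 16 = 4 \<or> d u * d v mod 16 = 8"
    if "u \<in> I" "v \<in> I" "u \<noteq> v" "even (d v)" for u v
  proof -
    obtain z where z: "d u * d v + r = z\<^sup>2"
      using squares \<open>u \<in> I\<close> \<open>v \<in> I\<close> \<open>u \<noteq> v\<close> by blast
    have "even r"
      using r by presburger
    then have "even (z\<^sup>2)"
      using that by (simp flip: z)
    then have "z\<^sup>2 mod 16 = 0 \<or> z\<^sup>2 mod 16 = 4"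
      by (rule square_mod_16_even)
    moreover have "d u * d v mod 16 = (z\<^sup>2 mod 16 - r mod 16) mod 16"
      by (simp add: mod_diff_eq flip: z)
    ultimately show ?thesis
      using r by auto
  qed
  have dvd: "4 dvd d l" if "l \<in> I" "even (d l)" for l
  proof -
    have "i \<noteq> l"
      using odd that by auto
    moreover have "4 dvd w" if "w mod 16 = 4 \<or> w mod 16 = 8" for w :: int
      using that by presburger
    ultimately have "4 dvd d i * d l"
      using prod_mod[OF \<open>i \<in> I\<close> that(1)] that(2) by blast
    moreover have "coprime 4 (d i)"
      using odd coprime_power_left_iff[of 2 2 "d i"] by simp
    ultimately show ?thesis
      by (simp add: coprime_dvd_mult_right_iff)
  qed
  have "4 * 4 dvd d j * d k"
    using dvd jk by (intro mult_dvd_mono)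
  then show False
    using prod_mod[OF jk(1-3,5)] by (auto simp: dvd_eq_mod_eq_0)
qed

section \<open>The corner equation modulo four\<close>

text \<open>
  The nonzero vectors of the plane over the field with two elements are counted by their
  parity patterns; independent vectors have different patterns.
\<close>

lemma card_pairwise_independent_mod_2:
  fixes t b :: "'i \<Rightarrow> int"
  assumes indep: "\<And>i j. i \<in> I \<Longrightarrow> j \<in> I \<Longrightarrow> i \<noteq> j \<Longrightarrow> odd (t i * b j + t j * b i)"
    and "1 < card I"
  shows "card I \<le> 3"
proof -
  let ?v = "\<lambda>i. (odd (t i), odd (b i))"
  have "inj_on ?v I"
    using indep by (force intro!: inj_onI)
  moreover have "?v ` I \<subseteq> {(True, True), (True, False), (False, True)}"
  proof -
    have "odd (t i) \<or> odd (b i)" if "i \<in> I" for i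
    proof -
      have "I \<noteq> {i}"
        using \<open>1 < card I\<close> by auto
      then obtain j where "j \<in> I" "i \<noteq> j"
        using \<open>i \<in> I\<close> by blast
      then show ?thesis
        using indep[OF \<open>i \<in> I\<close>, of j] by auto
    qed
    then show ?thesis
      by auto
  qed
  ultimately have "card I \<le> card {(True, True), (True, False), (False, True)}"
    by (intro card_inj_on_le) auto
  then show ?thesis
    by simp
qed

text \<open>
  Speaking of integer families rather than matrices lets the same contradiction serve both
  orders of the diagonals: \<open>a\<close> is the diagonal shifted by \<open>4\<close> and \<open>d\<close> the one shifted by \<open>12\<close>.
\<close>

lemma no_four_entries_with_jordan_equations:
  fixes a b d :: "'i \<Rightarrow> int"
  assumes card: "card I = 4" and p: "p mod 8 = 4" and r: "r mod 16 = 12" and q: "odd q"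
    and eqs: "\<And>i j. i \<in> I \<Longrightarrow> j \<in> I \<Longrightarrow> i \<noteq> j \<Longrightarrow>
      \<exists>x y z. a i * a j + p = x\<^sup>2 \<and> d i * d j + r = z\<^sup>2 \<and>
        (a i + d i) * b j + (a j + d j) * b i + 2 * q = 2 * (y * (x + z))"
  shows False
proof -
  have d_even: "even (d i)" if "i \<in> I" for i
    by (rule all_even_shift_12[OF card r _ that]) (use eqs in blast)
  have corner: "((a i + d i) * b j + (a j + d j) * b i) mod 4 = 2"
    if ij: "i \<in> I" "j \<in> I" "i \<noteq> j" and "even (a j)" for i j
  proof -
    obtain x y z where x: "a i * a j + p = x\<^sup>2" and z: "d i * d j + r = z\<^sup>2"
      and y: "(a i + d i) * b j + (a j + d j) * b i + 2 * q = 2 * (y * (x + z))"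
      using eqs[OF ij] by blast
    have "even p" "even r"
      using p r by presburger+
    then have "even (x\<^sup>2)" "even (z\<^sup>2)"
      using \<open>even (a j)\<close> d_even[OF \<open>j \<in> I\<close>] by (simp_all flip: x z)
    then have "even (y * (x + z))"
      by simp
    moreover have "u mod 4 = 2" if "u + 2 * q = 2 * w" "even w" for u w
      using that q by presburger
    ultimately show ?thesis
      using y by blast
  qed
  show False
  proof (cases "\<exists>i\<in>I. odd (a i)")
    case True
    then obtain i where i: "i \<in> I" "odd (a i)"
      by blast
    from two_even_shift_4[OF card p, of a] eqs
    obtain j k where jk: "j \<in> I" "k \<in> I" "j \<noteq> k" "even (a j)" "even (a k)"
      by metis
    have b_even: "even (b l)" if "l \<in> I" "even (a l)" for l
    proof -
      have "i \<noteq> l"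
        using i that by auto
      then have "even ((a i + d i) * b l + (a l + d l) * b i)"
        using corner[OF i(1) that(1) _ that(2)]
        by (metis dvd_mod_imp_dvd dvd_refl even_numeral)
      then show ?thesis
        using i that d_even by simp
    qed
    \<comment> \<open>Each term is a product of two even factors.\<close>
    have "2 * 2 dvd (a j + d j) * b k + (a k + d k) * b j"
      using jk b_even d_even by (intro dvd_add mult_dvd_mono) auto
    then show False
      using corner[OF jk(1-3,5)] by (simp add: dvd_eq_mod_eq_0)
  next
    case False
    let ?t = "\<lambda>i. (a i + d i) div 2"
    have "odd (?t i * b j + ?t j * b i)" if ij: "i \<in> I" "j \<in> I" "i \<noteq> j" for i j
    proof -
      have "a i + d i = 2 * ?t i" "a j + d j = 2 * ?t j"
        using False d_even ij by auto
      then have "(a i + d i) * b j + (a j + d j) * b i = 2 * (?t i * b j + ?t j * b i)"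
        by (metis distrib_left mult.assoc)
      then have "2 * (?t i * b j + ?t j * b i) mod 4 = 2"
        using corner[OF ij] False ij by metis
      moreover have "odd u" if "2 * u mod 4 = 2" for u :: int
        using that by presburger
      ultimately show ?thesis
        by blast
    qed
    then have "card I \<le> 3"
      by (rule card_pairwise_independent_mod_2) (use card in auto)
    then show False
      using card by simp
  qed
qed

section \<open>From matrices to their entries\<close>

lemma ut2_index:
  "ut2 a b d $$ (0, 0) = a" "ut2 a b d $$ (0, 1) = b" "ut2 a b d $$ (1, 1) = d"
  by (simp_all add: ut2_def mat_of_rows_list_def)

lemma UT2_D:
  assumes "A \<in> UT2"
  shows "dim_row A = 2" "dim_col A = 2" "A $$ (Suc 0, 0) = 0"
  using assms by (auto simp: UT2_def upper_triangular_def)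

lemma index_mult_mat_2:
  assumes "A \<in> carrier_mat 2 2" "B \<in> carrier_mat 2 2" "i < 2" "j < 2"
  shows "(A * B) $$ (i, j) = A $$ (i, 0) * B $$ (0, j) + A $$ (i, 1) * B $$ (1, j)"
  using assms by (simp add: scalar_prod_def numeral_2_eq_2)

lemma jordan_equation_entries:
  assumes A: "A \<in> UT2" and B: "B \<in> UT2" and X: "X \<in> UT2" and N: "N \<in> UT2"
    and eq: "rat_mat A \<circ>\<^sub>J rat_mat B + rat_mat N = rat_mat (X ^\<^sub>m 2)"
  shows "A $$ (0, 0) * B $$ (0, 0) + N $$ (0, 0) = (X $$ (0, 0))\<^sup>2"
    and "A $$ (1, 1) * B $$ (1, 1) + N $$ (1, 1) = (X $$ (1, 1))\<^sup>2"
    and "(A $$ (0, 0) + A $$ (1, 1)) * B $$ (0, 1) + (B $$ (0, 0) + B $$ (1, 1)) * A $$ (0, 1)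
        + 2 * N $$ (0, 1) = 2 * (X $$ (0, 1) * (X $$ (0, 0) + X $$ (1, 1)))"
proof -
  have carrier: "M \<in> carrier_mat 2 2" and lower: "M $$ (1, 0) = 0" if "M \<in> UT2" for M
    using that UT2_D[OF that] by (auto simp: UT2_def)
  note [simp] = carrier[OF A] carrier[OF B] carrier[OF X] carrier[OF N]
    lower[OF A, simplified] lower[OF B, simplified] lower[OF X, simplified]
    UT2_D(1,2)[OF A] UT2_D(1,2)[OF B] UT2_D(1,2)[OF X] UT2_D(1,2)[OF N]
  have sq: "X ^\<^sub>m 2 = X * X"
    by (simp add: numeral_2_eq_2)
  \<comment> \<open>Doubling clears the denominator of the Jordan product.\<close>
  have entry: "(A * B) $$ (i, j) + (B * A) $$ (i, j) + 2 * N $$ (i, j) = 2 * (X * X) $$ (i, j)"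
    if ij: "i < 2" "j < 2" for i j
  proof -
    have "(rat_mat A \<circ>\<^sub>J rat_mat B + rat_mat N) $$ (i, j) = rat_mat (X ^\<^sub>m 2) $$ (i, j)"
      by (simp only: eq)
    moreover have "rat_mat A * rat_mat B = rat_mat (A * B)" "rat_mat B * rat_mat A = rat_mat (B * A)"
      by (metis of_int_hom.mat_hom_mult carrier A B)+
    ultimately have "rat_of_int ((A * B) $$ (i, j) + (B * A) $$ (i, j) + 2 * N $$ (i, j))
        = rat_of_int (2 * (X * X) $$ (i, j))"
      using ij by (simp add: jordan_prod_def sq field_simps del: index_mult_mat(1))
    then show ?thesis
      by (simp only: of_int_eq_iff)
  qed
  show "A $$ (0, 0) * B $$ (0, 0) + N $$ (0, 0) = (X $$ (0, 0))\<^sup>2"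
    using entry[of 0 0] by (simp add: index_mult_mat_2 power2_eq_square del: index_mult_mat(1))
  show "A $$ (1, 1) * B $$ (1, 1) + N $$ (1, 1) = (X $$ (1, 1))\<^sup>2"
    using entry[of 1 1] by (simp add: index_mult_mat_2 power2_eq_square del: index_mult_mat(1))
  show "(A $$ (0, 0) + A $$ (1, 1)) * B $$ (0, 1) + (B $$ (0, 0) + B $$ (1, 1)) * A $$ (0, 1)
        + 2 * N $$ (0, 1) = 2 * (X $$ (0, 1) * (X $$ (0, 0) + X $$ (1, 1)))"
    using entry[of 0 1] by (simp add: index_mult_mat_2 algebra_simps del: index_mult_mat(1))
qed

text \<open>
  The property speaks of pairs \<open>i < j\<close> only; since the Jordan product is commutative, the
  entry equations are symmetric and hold for all pairs of distinct indices.
\<close>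

lemma jordan_D_property_entries:
  assumes A: "jordan_D_property (ut2 p q r) A" and ij: "i \<in> {1..4}" "j \<in> {1..4}" "i \<noteq> j"
  shows "\<exists>x y z. A i $$ (0, 0) * A j $$ (0, 0) + p = x\<^sup>2 \<and> A i $$ (1, 1) * A j $$ (1, 1) + r = z\<^sup>2 \<and>
    (A i $$ (0, 0) + A i $$ (1, 1)) * A j $$ (0, 1) + (A j $$ (0, 0) + A j $$ (1, 1)) * A i $$ (0, 1)
      + 2 * q = 2 * (y * (x + z))"
  using ij
proof (induction i j rule: linorder_wlog)
  case (le i j)
  then have "1 \<le> i \<and> i < j \<and> j \<le> 4"
    by auto
  with A obtain X where X: "X \<in> UT2"
    "rat_mat (A i) \<circ>\<^sub>J rat_mat (A j) + rat_mat (ut2 p q r) = rat_mat (X ^\<^sub>m 2)"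
    unfolding jordan_D_property_def by blast
  have "A i \<in> UT2" "A j \<in> UT2"
    using A le by (auto simp: jordan_D_property_def)
  from jordan_equation_entries[OF this X(1) ut2_in_UT2 X(2)] show ?case
    unfolding ut2_index by blast
next
  case (sym i j)
  then obtain x y z where "A j $$ (0, 0) * A i $$ (0, 0) + p = x\<^sup>2"
    "A j $$ (1, 1) * A i $$ (1, 1) + r = z\<^sup>2"
    "(A j $$ (0, 0) + A j $$ (1, 1)) * A i $$ (0, 1) + (A i $$ (0, 0) + A i $$ (1, 1)) * A j $$ (0, 1)
      + 2 * q = 2 * (y * (x + z))"
    by blast
  then show ?case
    by (intro exI[of _ x] exI[of _ y] exI[of _ z]) (simp add: mult.commute add.commute)
qed

theorem proposition17:
  fixes k m n :: int and N :: "int mat"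
  assumes "N = ut2 (16 * k + 4) (2 * m + 1) (16 * n + 12) \<or>
           N = ut2 (16 * k + 12) (2 * m + 1) (16 * n + 4)"
  shows "\<not> (\<exists>A. jordan_D_property N A) \<and> \<not> (\<exists>Q. jordan_D_quadruple N Q)"
proof -
  have "\<not> jordan_D_property N A" for A
  proof
    assume D: "jordan_D_property N A"
    let ?a = "\<lambda>i. A i $$ (0, 0)" and ?b = "\<lambda>i. A i $$ (0, 1)" and ?d = "\<lambda>i. A i $$ (1, 1)"
    have card: "card {1..4::nat} = 4" and q: "odd (2 * m + 1)"
      by simp_all
    from assms show False
    proof
      assume N: "N = ut2 (16 * k + 4) (2 * m + 1) (16 * n + 12)"
      have "(16 * k + 4) mod 8 = 4" "(16 * n + 12) mod 16 = 12"
        by presburger+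
      from no_four_entries_with_jordan_equations[OF card this q, of ?a ?d ?b]
      show False
        using jordan_D_property_entries[OF D[unfolded N]] by blast
    next
      assume N: "N = ut2 (16 * k + 12) (2 * m + 1) (16 * n + 4)"
      have "(16 * n + 4) mod 8 = 4" "(16 * k + 12) mod 16 = 12"
        by presburger+
      \<comment> \<open>The diagonals trade places here.\<close>
      note contradiction = no_four_entries_with_jordan_equations[OF card this q, of ?d ?a ?b]
      show False
      proof (rule contradiction)
        fix i j :: nat
        assume "i \<in> {1..4}" "j \<in> {1..4}" "i \<noteq> j"
        from jordan_D_property_entries[OF D[unfolded N] this]
        show "\<exists>x y z. ?d i * ?d j + (16 * n + 4) = x\<^sup>2 \<and> ?a i * ?a j + (16 * k + 12) = z\<^sup>2 \<and>
            (?d i + ?a i) * ?b j + (?d j + ?a j) * ?b i + 2 * (2 * m + 1) = 2 * (y * (x + z))"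
          by (metis add.commute)
      qed
    qed
  qed
  then show ?thesis
    by (auto simp: jordan_D_quadruple_def)
qed

end
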